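(* Let $(X_i)_{i=1}^\infty$ be independent with $X_i\sim\mathrm{Exp}(i)$ and $M=\sup_{i\ge1}X_i$. Then as $m\to\infty$, $$P(X_m=M)=\pi\sqrt{2m}\;e^{-\pi\sqrt{2/3}\,\sqrt m}\,(1+o(1)).$$
   Context: $\mathrm{Exp}(\lambda)$ denotes the exponential distribution with rate $\lambda$ (density $\lambda e^{-\lambda x}$, $x\ge0$). *)

theory Defs
  imports "HOL-Probability.Probability" "HOL-Library.Landau_Symbols"
begin

end

theory Submission
  imports Defs "HOL-Real_Asymp.Real_Asymp"
begin

text \<open>
  Conditioning on \<open>X\<^sub>m\<close>, the probability equals the integral over \<open>x > 0\<close> of
  \<open>m exp (- m x) / (1 - exp (- m x)) \<cdot> \<phi> x\<close> with \<open>\<phi> x = \<Prod>(1 - exp (- i x))\<close>. Expanding the geometric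
  series turns it into \<open>m \<Sum> L (r m)\<close> over \<open>r \<ge> 1\<close>, where \<open>L\<close> is the Laplace transform of \<open>\<phi>\<close>. By Euler's
  pentagonal number theorem (proved via Shanks' finite identity), \<open>L s\<close> is the sum over all integers
  \<open>k\<close> of \<open>(-1)\<^sup>k / (s + k (3 k - 1) / 2)\<close>, which the partial fraction expansion of \<open>\<pi> / sin (\<pi> z)\<close>
  evaluates in closed form. The term \<open>r = 1\<close> gives the asymptotics, and the terms \<open>r \<ge> 2\<close> are
  exponentially smaller.
\<close>

subsection \<open>The pentagonal number theorem\<close>

text \<open>A finite form of the pentagonal number theorem: the summand \<open>s = 0\<close> is the
  Euler product up to \<open>n\<close>, and the right-hand side is a partial sum of the pentagonal
  series plus the first half of its next pair. Induction on \<open>n\<close> avoids division, so any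
  commutative ring will do.\<close>

lemma shanks_identity:
  fixes q :: "'a :: comm_ring_1"
  shows "(\<Sum>s\<le>n. (-1)^s * (\<Prod>i=Suc s..n. 1 - q^i) * q^(s*n + s*(s+1) div 2))
       = (\<Sum>j<n. (-1)^j * (q^(j*(3*j+1) div 2) - q^((j+1)*(3*j+2) div 2)))
         + (-1)^n * q^(n*(3*n+1) div 2)"
proof (induction n)
  case 0
  show ?case by simp
next
  case (Suc n)
  define P where "P s = (\<Prod>i=Suc s..n. 1 - q^i)" for s
  define t where "t s = s*(s+1) div 2" for s :: nat
  have t_Suc: "t (Suc s) = t s + Suc s" for s
    by (simp add: t_def)
  have P_rec: "P s = (1 - q ^ Suc s) * P (Suc s)" if "s < n" for s
    using that by (simp add: P_def prod.atLeast_Suc_atMost)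
  have [simp]: "P n = 1" by (simp add: P_def)
  have eq: "(\<Prod>i=Suc s..Suc n. 1 - q^i) = P s * (1 - q ^ Suc n)" if "s \<le> n" for s
    using that by (simp add: P_def prod.nat_ivl_Suc')
  \<comment> \<open>Multiplying out the new factor \<open>1 - q ^ Suc n\<close> splits each summand
    in two. The second piece carries the sign and exponent of index \<open>Suc s\<close> in the sum
    for \<open>n\<close>.\<close>
  have "(\<Sum>s\<le>n. (-1)^s * (\<Prod>i=Suc s..Suc n. 1 - q^i) * q^(s * Suc n + t s))
      = (\<Sum>s\<le>n. (-1)^s * P s * q^(s*n + t s) * q^s) + (\<Sum>s\<le>n. (-1)^Suc s * P s * q^(Suc s * n + t (Suc s)))"
    unfolding sum.distrib[symmetric]
  proof (intro sum.cong refl)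
    fix s assume "s \<in> {..n}"
    hence "(-1)^s * (\<Prod>i=Suc s..Suc n. 1 - q^i) * q^(s * Suc n + t s) =
           (-1)^s * P s * q^(s*n+t s) * q^s * (1 - q ^ Suc n)"
      by (simp add: eq power_add mult_ac del: prod.cl_ivl_Suc)
    also have "\<dots> = (-1)^s * P s * q^(s*n + t s) * q^s + (-1)^Suc s * P s * q^(Suc s * n + t (Suc s))"
      by (simp add: t_Suc power_add algebra_simps)
    finally show "(-1)^s * (\<Prod>i=Suc s..Suc n. 1 - q^i) * q^(s * Suc n + t s) = \<dots>" .
  qed
  also have "(\<Sum>s\<le>n. (-1)^Suc s * P s * q^(Suc s * n + t (Suc s)))
     = (\<Sum>s<n. (-1)^Suc s * P s * q^(Suc s * n + t (Suc s))) + (-1)^Suc n * q^(Suc n * n + t (Suc n))"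
    by (simp add: lessThan_Suc_atMost[symmetric])
  also have "(\<Sum>s\<le>n. (-1)^s * P s * q^(s*n + t s) * q^s)
     = P 0 + (\<Sum>s<n. (-1)^Suc s * P (Suc s) * q^(Suc s * n + t (Suc s)) * q ^ Suc s)"
    by (subst sum.atMost_shift) (simp add: t_def)
  also have "P 0 + (\<Sum>s<n. (-1)^Suc s * P (Suc s) * q^(Suc s * n + t (Suc s)) * q ^ Suc s) +
      ((\<Sum>s<n. (-1)^Suc s * P s * q^(Suc s * n + t (Suc s))) + (-1)^Suc n * q^(Suc n * n + t (Suc n)))
    = P 0 + (\<Sum>s<n. (-1)^Suc s * P (Suc s) * q^(Suc s * n + t (Suc s))) + (-1)^Suc n * q^(Suc n * n + t (Suc n))"
  proof -
    \<comment> \<open>Since \<open>P s = (1 - q ^ Suc s) * P (Suc s)\<close>, adding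
      \<open>P (Suc s) * q ^ Suc s\<close> restores \<open>P (Suc s)\<close>, so the sum for
      \<open>n\<close> reappears.\<close>
    have "(\<Sum>s<n. (-1)^Suc s * P (Suc s) * q^(Suc s * n + t (Suc s)) * q ^ Suc s) +
      (\<Sum>s<n. (-1)^Suc s * P s * q^(Suc s * n + t (Suc s))) =
      (\<Sum>s<n. (-1)^Suc s * P (Suc s) * q^(Suc s * n + t (Suc s)))"
      unfolding sum.distrib[symmetric]
      by (intro sum.cong refl) (simp add: P_rec algebra_simps)
    thus ?thesis by (simp add: add_ac)
  qed
  also have "P 0 + (\<Sum>s<n. (-1)^Suc s * P (Suc s) * q^(Suc s * n + t (Suc s)))
    = (\<Sum>s\<le>n. (-1)^s * P s * q^(s*n + t s))"
    by (subst sum.atMost_shift) (simp add: t_def)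
  also have "\<dots> = (\<Sum>j<n. (-1)^j * (q^(j*(3*j+1) div 2) - q^((j+1)*(3*j+2) div 2)))
         + (-1)^n * q^(n*(3*n+1) div 2)"
    using Suc.IH by (simp add: P_def t_def)
  finally have main: "(\<Sum>s\<le>n. (-1)^s * (\<Prod>i=Suc s..Suc n. 1 - q^i) * q^(s * Suc n + t s)) =
     (\<Sum>j<n. (-1)^j * (q^(j*(3*j+1) div 2) - q^((j+1)*(3*j+2) div 2)))
         + (-1)^n * q^(n*(3*n+1) div 2) + (-1)^Suc n * q^(Suc n * n + t (Suc n))" .
  \<comment> \<open>The boundary term left over at \<open>s = n\<close> completes the pair
    \<open>j = n\<close>, and the new summand \<open>s = Suc n\<close> opens the pair
    \<open>j = Suc n\<close>.\<close>
  have ex1: "Suc n * n + t (Suc n) = (n+1)*(3*n+2) div 2"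
  proof -
    have "(n+1)*(3*n+2) = Suc n * (n + 2) + (Suc n * n) * 2" by (simp add: algebra_simps)
    thus ?thesis by (simp add: t_def del: mult_Suc mult_Suc_right)
  qed
  have ex2: "Suc n * Suc n + t (Suc n) = Suc n * (3 * Suc n + 1) div 2"
  proof -
    have "Suc n * (3 * Suc n + 1) = Suc n * (n + 2) + (Suc n * Suc n) * 2" by (simp add: algebra_simps)
    thus ?thesis by (simp add: t_def del: mult_Suc mult_Suc_right)
  qed
  have "(\<Sum>s\<le>Suc n. (-1)^s * (\<Prod>i=Suc s..Suc n. 1 - q^i) * q^(s*Suc n + t s))
    = (\<Sum>s\<le>n. (-1)^s * (\<Prod>i=Suc s..Suc n. 1 - q^i) * q^(s * Suc n + t s)) + (-1)^Suc n * q^(Suc n * Suc n + t (Suc n))"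
    by (subst sum.atMost_Suc) simp
  also have "\<dots> = (\<Sum>j<Suc n. (-1)^j * (q^(j*(3*j+1) div 2) - q^((j+1)*(3*j+2) div 2)))
         + (-1)^Suc n * q^(Suc n*(3*Suc n+1) div 2)"
    unfolding main ex1 ex2 by (simp add: algebra_simps del: mult_Suc mult_Suc_right)
  finally show ?case unfolding t_def .
qed

text \<open>The exponents are the generalized pentagonal numbers \<open>k (3 k - 1) / 2\<close> at \<open>k = - j\<close> and
  \<open>k = j + 1\<close>; this pairing of indices is the one that matches the partial fractions of
  \<open>\<pi> / sin (\<pi> z)\<close> below.\<close>

definition pentagonal_term :: "real \<Rightarrow> nat \<Rightarrow> real" where
  "pentagonal_term q j = (-1)^j * (q^(j*(3*j+1) div 2) - q^((j+1)*(3*j+2) div 2))"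

lemma pentagonal_exponent_ge:
  "j \<le> j*(3*j+1) div 2" "j \<le> (j+1)*(3*j+2) div 2" for j :: nat
proof -
  have "2 * j \<le> j*(3*j+1)" by (cases j) auto
  thus "j \<le> j*(3*j+1) div 2" by linarith
  have "2 * j \<le> (j+1)*(3*j+2)" by (simp add: algebra_simps)
  thus "j \<le> (j+1)*(3*j+2) div 2" by linarith
qed

lemma summable_pentagonal:
  assumes "0 \<le> q" "q < 1"
  shows "summable (\<lambda>j. norm (pentagonal_term q j))"
proof (rule summable_comparison_test')
  show "summable (\<lambda>j. 2 * q^j)" using assms by (intro summable_mult summable_geometric) auto
  fix j :: nat
  have "\<bar>q^(j*(3*j+1) div 2) - q^((j+1)*(3*j+2) div 2)\<bar> \<le> q^(j*(3*j+1) div 2) + q^((j+1)*(3*j+2) div 2)"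
    using assms by (intro order.trans[OF abs_triangle_ineq4]) auto
  also have "\<dots> \<le> q^j + q^j"
    using assms pentagonal_exponent_ge[of j] by (intro add_mono power_decreasing) auto
  finally show "norm (norm (pentagonal_term q j)) \<le> 2 * q^j"
    by (simp add: pentagonal_term_def abs_mult)
qed

text \<open>Let \<open>n\<close> tend to infinity in Shanks' identity. Each of the \<open>n\<close>
  summands with \<open>s > 0\<close> is at most \<open>q ^ n\<close> in absolute value, because its
  product lies in [0, 1] and its exponent is at least \<open>n\<close>. Their sum \<open>R n\<close>
  is therefore at most \<open>n * q ^ n\<close>, which vanishes.\<close>

lemma pentagonal_number_theorem:
  assumes "0 \<le> q" "q < (1::real)"
  shows "(\<lambda>n. \<Prod>i=1..n. 1 - q^i) \<longlonglongrightarrow> (\<Sum>j. pentagonal_term q j)"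
proof -
  define P where "P s n = (\<Prod>i=Suc s..n. 1 - q^i)" for s n
  have P: "0 \<le> P s n" "P s n \<le> 1" for s n
    unfolding P_def using assms
    by (auto intro!: prod_nonneg prod_le_1 simp: power_le_one)
  define R where "R n = (\<Sum>s<n. (-1)^Suc s * P (Suc s) n * q^(Suc s * n + Suc s*(Suc s+1) div 2))" for n
  have R: "norm (R n) \<le> real n * q ^ n" for n
  proof -
    have "norm (R n) \<le> (\<Sum>s<n. q^n)"
      unfolding R_def
    proof (rule sum_norm_le)
      fix s assume "s \<in> {..<n}"
      have "norm ((-1)^Suc s * P (Suc s) n * q^(Suc s * n + Suc s*(Suc s+1) div 2))
          \<le> 1 * q^(Suc s * n + Suc s*(Suc s+1) div 2)"
        using P[of "Suc s" n] assms
        by (simp add: abs_mult mult_left_le_one_le del: mult_Suc mult_Suc_right)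
      also have "\<dots> \<le> q ^ n"
        unfolding mult_1 using assms by (intro power_decreasing) auto
      finally show "norm ((-1)^Suc s * P (Suc s) n * q^(Suc s * n + Suc s*(Suc s+1) div 2)) \<le> q ^ n" .
    qed
    thus ?thesis by simp
  qed
  have lim0: "(\<lambda>n. real n * q ^ n) \<longlonglongrightarrow> 0"
    using powser_times_n_limit_0[of q] assms by simp
  have R0: "R \<longlonglongrightarrow> 0"
    by (rule Lim_null_comparison[OF _ lim0]) (use R in auto)
  have E0: "(\<lambda>n. (-1)^n * q^(n*(3*n+1) div 2)) \<longlonglongrightarrow> 0"
  proof (rule Lim_null_comparison)
    show "(\<lambda>n. q ^ n) \<longlonglongrightarrow> 0" using assms by (intro LIMSEQ_power_zero) auto
    show "\<forall>\<^sub>F n in sequentially. norm ((-1)^n * q^(n*(3*n+1) div 2)) \<le> q ^ n"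
      using assms pentagonal_exponent_ge(1)
      by (intro always_eventually allI) (auto simp: abs_mult intro!: power_decreasing)
  qed
  have eq: "(\<Prod>i=1..n. 1 - q^i) = (\<Sum>j<n. pentagonal_term q j) + (-1)^n * q^(n*(3*n+1) div 2) - R n" for n
  proof -
    have "(\<Sum>s\<le>n. (-1)^s * P s n * q^(s*n + s*(s+1) div 2)) = P 0 n + R n"
      unfolding R_def by (subst sum.atMost_shift) simp
    thus ?thesis
      using shanks_identity[of q n] by (simp add: P_def pentagonal_term_def)
  qed
  have "(\<lambda>n. (\<Sum>j<n. pentagonal_term q j) + (-1)^n * q^(n*(3*n+1) div 2) - R n)
      \<longlonglongrightarrow> (\<Sum>j. pentagonal_term q j) + 0 - 0"
    using summable_norm_cancel[OF summable_pentagonal[OF assms]]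
    by (intro tendsto_intros summable_LIMSEQ E0 R0)
  thus ?thesis unfolding eq by simp
qed

subsection \<open>Partial fractions\<close>

text \<open>Differentiate both sides of \<open>Gamma z * Gamma (1 - z) = pi / sin (pi * z)\<close>
  and divide by the Gamma product.\<close>

lemma Digamma_reflection_complex:
  fixes z :: complex
  assumes "z \<notin> \<int>"
  shows "Digamma (1 - z) - Digamma z = of_real pi * cot (of_real pi * z)"
proof -
  have nz: "z \<notin> \<int>\<^sub>\<le>\<^sub>0" "1 - z \<notin> \<int>\<^sub>\<le>\<^sub>0"
    using assms nonpos_Ints_subset_Ints Ints_diff[of 1 "1-z"] by auto
  have sin: "sin (of_real pi * z) \<noteq> 0"
    using assms by (auto simp: sin_eq_0 elim!: Ints_cases)
  have G: "Gamma z \<noteq> 0" "Gamma (1 - z) \<noteq> 0"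
    using nz by (auto simp: Gamma_eq_zero_iff)
  have "((\<lambda>z. Gamma z * Gamma (1 - z)) has_field_derivative
       Gamma z * Gamma (1 - z) * (Digamma z - Digamma (1 - z))) (at z)"
    using nz by (auto intro!: derivative_eq_intros simp: algebra_simps)
  moreover have "((\<lambda>z. of_real pi / sin (of_real pi * z)) has_field_derivative
       - (of_real pi * (of_real pi * cos (of_real pi * z)) / (sin (of_real pi * z))^2)) (at z)"
    using sin by (auto intro!: derivative_eq_intros simp: algebra_simps power2_eq_square)
  ultimately have "Gamma z * Gamma (1 - z) * (Digamma z - Digamma (1 - z)) =
       - (of_real pi * (of_real pi * cos (of_real pi * z)) / (sin (of_real pi * z))^2)"
    unfolding Gamma_reflection_complex using DERIV_unique by blast
  also have "\<dots> = Gamma z * Gamma (1 - z) * (- (of_real pi * cot (of_real pi * z)))"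
    unfolding Gamma_reflection_complex by (simp add: cot_def power2_eq_square)
  finally have "Digamma z - Digamma (1 - z) = - (of_real pi * cot (of_real pi * z))"
    using G by (simp only: mult_cancel_left) auto
  thus ?thesis by (simp add: algebra_simps)
qed

text \<open>The difference of the Digamma series at \<open>1 - z\<close> and at \<open>z\<close>, in
  which the harmonic terms and Euler's constant cancel.\<close>

lemma cot_partial_fractions:
  fixes z :: complex
  assumes "z \<notin> \<int>"
  shows "(\<lambda>n. 1 / (z + of_nat n) - 1 / (1 - z + of_nat n)) sums (of_real pi * cot (of_real pi * z))"
proof -
  have nz: "z \<noteq> 0" "1 - z \<noteq> 0" using assms by auto
  have D: "(\<lambda>k. inverse (of_nat (Suc k)) - inverse (z + of_nat k)) sums (Digamma z + euler_mascheroni)"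
    if "z \<noteq> 0" for z :: complex
    using summable_sums[OF summable_Digamma[OF that]] by (simp add: Digamma_def)
  from sums_diff[OF D[OF nz(2)] D[OF nz(1)]] show ?thesis
    using Digamma_reflection_complex[OF assms] by (simp add: divide_inverse)
qed

text \<open>Uses \<open>2 / sin (2 * w) = cot w + tan w\<close> together with
  \<open>cot (w + pi / 2) = - tan w\<close>: half the difference of the cotangent series at
  \<open>z / 2\<close> and \<open>(z + 1) / 2\<close> is the alternating series with consecutive
  terms grouped in pairs.\<close>

lemma cosecant_partial_fractions:
  fixes z :: complex
  assumes "z \<notin> \<int>"
  shows "(\<lambda>j. (-1)^j * (1 / (z + of_nat j) + 1 / (1 - z + of_nat j))) sums (of_real pi / sin (of_real pi * z))"
proof -
  have 1: "z / 2 \<notin> \<int>" using assms Ints_mult[of 2 "z/2"] by auto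
  have 2: "(z + 1) / 2 \<notin> \<int>"
  proof
    assume "(z + 1) / 2 \<in> \<int>"
    hence "2 * ((z + 1) / 2) - 1 \<in> \<int>" by (intro Ints_diff Ints_mult) auto
    thus False using assms by (simp add: field_simps)
  qed
  define w where "w = of_real pi * (z / 2)"
  define f where "f j = (-1)^j * (1 / (z + of_nat j) + 1 / (1 - z + of_nat j))" for j
  have sin: "sin w \<noteq> 0"
    using 1 by (auto simp: sin_eq_0 w_def elim!: Ints_cases)
  have cos: "cos w \<noteq> 0"
  proof -
    have "sin (of_real pi * ((z+1)/2)) \<noteq> 0"
      using 2 by (auto simp: sin_eq_0 elim!: Ints_cases)
    also have "of_real pi * ((z+1)/2) = w + of_real pi / 2" by (simp add: w_def field_simps)
    finally show ?thesis by (simp add: sin_add)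
  qed
  have s: "(\<lambda>n. (1/2) * ((1 / (z/2 + of_nat n) - 1 / (1 - z/2 + of_nat n)) -
               (1 / ((z+1)/2 + of_nat n) - 1 / (1 - (z+1)/2 + of_nat n))))
      sums ((1/2) * (of_real pi * cot (of_real pi * (z/2)) - of_real pi * cot (of_real pi * ((z+1)/2))))"
    by (intro sums_mult sums_diff cot_partial_fractions 1 2)
  have "of_real pi * ((z+1)/2) = w + of_real pi / 2" by (simp add: w_def field_simps)
  hence "(1/2) * (of_real pi * cot (of_real pi * (z/2)) - of_real pi * cot (of_real pi * ((z+1)/2)))
      = of_real pi / 2 * (cos w / sin w + sin w / cos w)"
    unfolding w_def[symmetric] by (simp only:) (simp add: cot_def sin_add cos_add ring_distribs)
  also have "cos w / sin w + sin w / cos w = 1 / (sin w * cos w)"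
    using sin cos by (simp add: field_simps flip: power2_eq_square)
  also have "of_real pi / 2 * (1 / (sin w * cos w)) = of_real pi / sin (2 * w)"
    by (simp add: sin_double)
  also have "2 * w = of_real pi * z" by (simp add: w_def)
  finally have val: "(1/2) * (of_real pi * cot (of_real pi * (z/2)) - of_real pi * cot (of_real pi * ((z+1)/2)))
      = of_real pi / sin (of_real pi * z)" .
  have pair: "(1/2) * ((1 / (z/2 + of_nat n) - 1 / (1 - z/2 + of_nat n)) -
               (1 / ((z+1)/2 + of_nat n) - 1 / (1 - (z+1)/2 + of_nat n))) = f (2*n) + f (2*n+1)" for n
  proof -
    have half: "(1/2) * (1 / x) = 1 / (2 * x)" for x :: complex by simp
    have eqs: "2 * (z/2 + of_nat n) = z + of_nat (2*n)" "2 * (1 - z/2 + of_nat n) = 1 - z + of_nat (2*n+1)"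
         "2 * ((z+1)/2 + of_nat n) = z + of_nat (2*n+1)" "2 * (1 - (z+1)/2 + of_nat n) = 1 - z + of_nat (2*n)"
      by (simp_all add: ring_distribs add_divide_distrib)
    show ?thesis unfolding f_def right_diff_distrib half eqs by simp
  qed
  \<comment> \<open>The convergence is only conditional, so the grouping cannot be undone freely.
    The grouped series gives the even partial sums, and \<open>f\<close> tending to 0 carries the
    limit over to the odd ones.\<close>
  have even: "(\<lambda>n. \<Sum>i<2*n. f i) \<longlonglongrightarrow> of_real pi / sin (of_real pi * z)"
  proof -
    have "(\<Sum>i<2*n. f i) = (\<Sum>i<n. f (2*i) + f (2*i+1))" for n
      by (induction n) auto
    thus ?thesis using s unfolding sums_def val pair by simp
  qed
  have f0: "f \<longlonglongrightarrow> 0"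
  proof -
    have "(\<lambda>j. 1 / (z + of_nat j) + 1 / (1 - z + of_nat j)) \<longlonglongrightarrow> 0 + 0"
      by (intro tendsto_add tendsto_divide_0[OF tendsto_const]
                tendsto_add_filterlim_at_infinity[OF tendsto_const] tendsto_of_nat)
    hence "(\<lambda>j. norm (f j)) \<longlonglongrightarrow> 0"
      by (auto simp: f_def norm_mult norm_power dest: tendsto_norm)
    thus ?thesis by (rule tendsto_norm_zero_cancel)
  qed
  have odd: "(\<lambda>n. \<Sum>i<2*n+1. f i) \<longlonglongrightarrow> of_real pi / sin (of_real pi * z)"
    using tendsto_add[OF even LIMSEQ_subseq_LIMSEQ[OF f0, of "\<lambda>n. 2*n"]]
    by (simp add: strict_mono_def o_def)
  show ?thesis
    unfolding sums_def f_def[symmetric]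
    using even odd by (rule limseq_even_odd[where f = "\<lambda>n. \<Sum>i<n. f i"])
qed

subsection \<open>The Laplace transform of the Euler product\<close>

text \<open>This is the closed form of the integral of \<open>exp (- s x) \<Prod>(1 - exp (- i x))\<close> over \<open>x > 0\<close>. The number
  \<open>a\<close> comes from completing the square:
  \<open>s + k (3 k - 1) / 2 = (3 / 2) ((k - 1 / 6)\<^sup>2 + a\<^sup>2)\<close>.\<close>

definition pentagonal_laplace :: "real \<Rightarrow> real" where
  "pentagonal_laplace s = (let a = sqrt (2 * s / 3 - 1 / 36); S = sinh (pi * a)
     in pi / sqrt 3 * S / (a * (S^2 + 1 / 4)))"

text \<open>At real part 1/6 the angle is 30 degrees, so the squared modulus of the sine is the
  square of \<open>sinh (pi * a)\<close> plus 1/4.\<close>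

lemma Im_pi_over_sin:
  fixes a :: real
  shows "Im (of_real pi / sin (of_real pi * Complex (1/6) a)) =
           - (pi * sqrt 3 / 2 * sinh (pi * a) / ((sinh (pi * a))^2 + 1 / 4))"
proof -
  have Re: "Re (sin (of_real pi * Complex (1/6) a)) = cosh (pi * a) / 2"
    by (simp add: Re_sin cosh_field_def sin_30)
  have Im: "Im (sin (of_real pi * Complex (1/6) a)) = sqrt 3 / 2 * sinh (pi * a)"
    by (simp add: Im_sin sinh_field_def cos_30)
  have "(cosh (pi * a) / 2)^2 + (sqrt 3 / 2 * sinh (pi * a))^2 = (sinh (pi * a))^2 + 1/4"
    by (simp add: power_divide power_mult_distrib cosh_square_eq add_divide_distrib)
  thus ?thesis
    unfolding Im_divide Re Im by (simp add: power2_eq_square)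
qed

text \<open>Take imaginary parts in the cosecant expansion at \<open>z = Complex (1/6) a\<close>.
  The denominators \<open>z + j\<close> and \<open>1 - z + j\<close> have squared moduli equal to
  2/3 times \<open>s\<close> plus the two pentagonal exponents of the pair \<open>j\<close>.\<close>

lemma sums_pentagonal_laplace:
  assumes "s \<ge> 1"
  shows "(\<lambda>j. (-1)^j * (1 / (s + real (j*(3*j+1) div 2)) - 1 / (s + real ((j+1)*(3*j+2) div 2))))
           sums pentagonal_laplace s"
proof -
  define a where "a = sqrt (2 * s / 3 - 1 / 36)"
  have a: "a > 0" "a^2 = 2 * s / 3 - 1 / 36" using assms by (simp_all add: a_def)
  define z where "z = Complex (1/6) a"
  have "z \<notin> \<int>"
    using a by (auto simp: z_def complex_eq_iff elim!: Ints_cases)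
  from sums_Im[OF cosecant_partial_fractions[OF this]]
  have sums: "(\<lambda>j. Im ((-1)^j * (1 / (z + of_nat j) + 1 / (1 - z + of_nat j)))) sums
      - (pi * sqrt 3 / 2 * sinh (pi * a) / ((sinh (pi * a))^2 + 1 / 4))"
    unfolding z_def Im_pi_over_sin .
  \<comment> \<open>The factor cancels \<open>-3 * a / 2\<close>, which arises from the imaginary
    part \<open>-a\<close> and the scale 2/3 of the denominators.\<close>
  have "(-2 / (3 * a)) * Im ((-1)^j * (1 / (z + of_nat j) + 1 / (1 - z + of_nat j))) =
     (-1)^j * (1 / (s + real (j*(3*j+1) div 2)) - 1 / (s + real ((j+1)*(3*j+2) div 2)))" for j
  proof -
    have e1: "real (j*(3*j+1) div 2) = real j * (3 * real j + 1) / 2"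
      by (subst real_of_nat_div) (auto simp: algebra_simps)
    have e2: "real ((j+1)*(3*j+2) div 2) = (real j + 1) * (3 * real j + 2) / 2"
      by (subst real_of_nat_div) (auto simp: algebra_simps)
    have d1: "(1/6 + real j)^2 + a^2 = 2/3 * (s + real (j*(3*j+1) div 2))"
      unfolding e1 a(2) by (simp add: power2_eq_square field_simps)
    have d2: "(5/6 + real j)^2 + a^2 = 2/3 * (s + real ((j+1)*(3*j+2) div 2))"
      unfolding e2 a(2) by (simp add: power2_eq_square field_simps)
    have scale: "b / (2/3 * x) = (3 * b / 2) * (1 / x)" for b x :: real by simp
    have "(-1)^j = complex_of_real ((-1)^j)" by simp
    hence "Im ((-1)^j * (1 / (z + of_nat j) + 1 / (1 - z + of_nat j)))
       = (-1)^j * Im (1 / (z + of_nat j) + 1 / (1 - z + of_nat j))"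
      by (simp only: Im_complex_of_real Re_complex_of_real times_complex.sel)
    also have "Im (1 / (z + of_nat j) + 1 / (1 - z + of_nat j)) =
       - a / ((1/6 + real j)^2 + a^2) + a / ((5/6 + real j)^2 + a^2)"
      by (simp add: z_def Im_divide)
    also have "\<dots> = (-3 * a / 2) * (1 / (s + real (j*(3*j+1) div 2)) - 1 / (s + real ((j+1)*(3*j+2) div 2)))"
      unfolding d1 d2 scale right_diff_distrib by simp
    finally show ?thesis using a by simp
  qed
  with sums_mult[OF sums, of "-2 / (3 * a)"]
  have "(\<lambda>j. (-1)^j * (1 / (s + real (j*(3*j+1) div 2)) - 1 / (s + real ((j+1)*(3*j+2) div 2)))) sums
     ((-2 / (3 * a)) * - (pi * sqrt 3 / 2 * sinh (pi * a) / ((sinh (pi * a))^2 + 1 / 4)))" by simp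
  also have "(-2 / (3 * a)) * - (pi * sqrt 3 / 2 * sinh (pi * a) / ((sinh (pi * a))^2 + 1 / 4))
     = pentagonal_laplace s"
  proof -
    have sqrt3: "pi / sqrt 3 = pi * sqrt 3 / 3" by (simp add: field_simps)
    have "(-2 / (3 * a)) * - (pi * sqrt 3 / 2 * S / T) = pi / sqrt 3 * S / (a * T)" for S T
      unfolding sqrt3 by (simp add: mult_ac)
    thus ?thesis unfolding pentagonal_laplace_def Let_def a_def[symmetric] by blast
  qed
  finally show ?thesis .
qed

text \<open>Read off from the total mass 1 of the exponential density; the two integrands differ at
  most at the origin, a null set.\<close>

lemma has_bochner_integral_exp_halfline:
  assumes "c > (0::real)"
  shows "has_bochner_integral lborel (\<lambda>x. indicator {0<..} x * exp (- c * x)) (1 / c)"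
proof -
  have "has_bochner_integral lborel (\<lambda>x. exponential_density c x / c) (1 / c)"
  proof (rule has_bochner_integral_divide_zero, rule has_bochner_integral_nn_integral)
    interpret prob_space "density lborel (exponential_density c)"
      by (rule prob_space_exponential_density) fact
    show "(\<integral>\<^sup>+x. ennreal (exponential_density c x) \<partial>lborel) = ennreal 1"
      using emeasure_space_1 by (simp add: emeasure_density)
  qed (use assms in \<open>auto simp: exponential_density_nonneg\<close>)
  moreover have "AE x in lborel. exponential_density c x / c = indicator {0<..} x * exp (- c * x)"
    using AE_lborel_singleton[of 0]
    by eventually_elim (use assms in \<open>auto simp: exponential_density_def indicator_def mult.commute\<close>)
  ultimately show ?thesis
    by (subst has_bochner_integral_cong_AE[symmetric]) auto
qed

lemma pentagonal_term_measurable [measurable]: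
  "(\<lambda>q. pentagonal_term q j) \<in> borel_measurable borel"
  unfolding pentagonal_term_def by measurable

text \<open>Termwise integration: a power of \<open>exp (- x)\<close> with exponent \<open>p\<close>
  contributes \<open>1 / (s + p)\<close>. The interchange is justified because the integrals of the
  absolute values decay at least like the inverse square of \<open>j\<close>.\<close>

lemma has_bochner_integral_pentagonal:
  assumes s: "s \<ge> 1"
  shows "has_bochner_integral lborel
           (\<lambda>x. indicator {0<..} x * (exp (- s * x) * (\<Sum>j. pentagonal_term (exp (- x)) j)))
           (pentagonal_laplace s)"
proof -
  define p p' where "p j = j*(3*j+1) div 2" and "p' j = (j+1)*(3*j+2) div 2" for j :: nat
  define f where "f j x = indicator {0<..} x * (exp (- s * x) * pentagonal_term (exp (- x)) j)" for j and x :: real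
  define c where "c j = 1 / (s + real (p j)) - 1 / (s + real (p' j))" for j
  have pp': "p j \<le> p' j" for j
    unfolding p_def p'_def by (intro div_le_mono mult_le_mono) auto
  have p_ge: "j^2 \<le> p j" for j
  proof -
    have "2 * j^2 \<le> j*(3*j+1)" by (simp add: power2_eq_square algebra_simps)
    thus ?thesis unfolding p_def by linarith
  qed
  have f_eq: "f j x = (-1)^j * (indicator {0<..} x * exp (-(s + real (p j)) * x)
                       - indicator {0<..} x * exp (-(s + real (p' j)) * x))" for j x
    unfolding f_def pentagonal_term_def p_def[symmetric] p'_def[symmetric]
    by (simp add: exp_of_nat_mult[symmetric] ring_distribs exp_add[symmetric] mult_ac)
  have "has_bochner_integral lborel (\<lambda>x. indicator {0<..} x * exp (-(s + real (p j)) * x)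
                       - indicator {0<..} x * exp (-(s + real (p' j)) * x)) (c j)" for j
    unfolding c_def using s
    by (intro has_bochner_integral_diff has_bochner_integral_exp_halfline) auto
  hence hb: "has_bochner_integral lborel (f j) ((-1)^j * c j)" for j
    unfolding f_eq[abs_def] by (rule has_bochner_integral_mult_right)
  \<comment> \<open>The first exponent of a pair is the smaller one, so \<open>f j\<close> has the
    constant sign of \<open>(-1)^j\<close>, and its absolute integral is \<open>c j\<close>.\<close>
  have norm_f: "norm (f j x) = (-1)^j * f j x" for j x
  proof -
    have "exp (-(s + real (p' j)) * x) \<le> exp (-(s + real (p j)) * x)" if "x > 0"
      using that pp'[of j] by (simp add: algebra_simps)
    hence "0 \<le> indicator {0<..} x * exp (-(s + real (p j)) * x)
                       - indicator {0<..} x * exp (-(s + real (p' j)) * x)"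
      by (simp add: indicator_def)
    thus ?thesis by (simp add: f_eq abs_mult flip: power_mult_distrib mult.assoc)
  qed
  have "has_bochner_integral lborel (\<lambda>x. norm (f j x)) (c j)" for j
    using has_bochner_integral_mult_right[OF hb, of "(-1)^j" j] unfolding norm_f
    by (simp flip: power_mult_distrib mult.assoc)
  hence int_norm: "(\<integral>x. norm (f j x) \<partial>lborel) = c j" for j
    by (rule has_bochner_integral_integral_eq)
  have summ: "summable c"
  proof (rule summable_comparison_test')
    show "summable (\<lambda>j. inverse (real j ^ 2))" by (rule inverse_power_summable) simp
    fix j :: nat assume j: "j \<ge> 1"
    have "c j \<ge> 0" unfolding c_def using s pp'[of j] by (simp add: frac_le)
    moreover have "c j \<le> 1 / (s + real (p j))" unfolding c_def using s by simp
    moreover have "1 / (s + real (p j)) \<le> 1 / real (j^2)"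
      using s j p_ge[of j] by (intro divide_left_mono) (auto simp del: of_nat_power)
    ultimately show "norm (c j) \<le> inverse (real j ^ 2)" by (simp add: inverse_eq_divide)
  qed
  have summ_x: "summable (\<lambda>j. norm (f j x))" for x
  proof (cases "x > 0")
    case True
    thus ?thesis unfolding f_def norm_mult
      by (intro summable_mult summable_pentagonal) auto
  qed (simp add: f_def)
  have suminf_f: "(\<Sum>j. f j x) = indicator {0<..} x * (exp (- s * x) * (\<Sum>j. pentagonal_term (exp (- x)) j))" for x
  proof (cases "x > 0")
    case True
    hence "summable (\<lambda>j. pentagonal_term (exp (- x)) j)"
      by (intro summable_norm_cancel[OF summable_pentagonal]) auto
    thus ?thesis by (simp add: f_def suminf_mult)
  qed (simp add: f_def)
  have int: "integrable lborel (f j)" for j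
    using hb[of j] by (auto simp: has_bochner_integral_iff)
  have summ_int: "summable (\<lambda>j. \<integral>x. norm (f j x) \<partial>lborel)"
    unfolding int_norm by fact
  have "integrable lborel (\<lambda>x. \<Sum>j. f j x)"
    by (intro integrable_suminf int summ_int always_eventually allI summ_x)
  moreover have "(\<lambda>j. integral\<^sup>L lborel (f j)) sums (\<integral>x. (\<Sum>j. f j x) \<partial>lborel)"
    by (intro sums_integral int summ_int always_eventually allI summ_x)
  moreover have "integral\<^sup>L lborel (f j) = (-1)^j * c j" for j
    by (rule has_bochner_integral_integral_eq[OF hb])
  ultimately have "integrable lborel (\<lambda>x. \<Sum>j. f j x)" "(\<integral>x. (\<Sum>j. f j x) \<partial>lborel) = pentagonal_laplace s"
    using sums_pentagonal_laplace[OF s] sums_unique2 unfolding c_def p_def p'_def by auto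
  thus ?thesis by (simp add: has_bochner_integral_iff suminf_f)
qed

text \<open>In the variable \<open>2 s / 3\<close> the only transcendental constant is \<open>\<pi>\<close>, which keeps the
  exponents comparable for \<open>real_asymp\<close>.\<close>

lemma pentagonal_laplace_asymp:
  "(\<lambda>s. s * pentagonal_laplace s) \<sim>[at_top] (\<lambda>s. pi * sqrt (2 * s) * exp (- pi * sqrt (2/3) * sqrt s))"
proof -
  have "(\<lambda>u. u / 2 * sinh (pi * sqrt (u - 1/36)) / (sqrt (u - 1/36) * ((sinh (pi * sqrt (u - 1/36)))^2 + 1/4)))
      \<sim>[at_top] (\<lambda>u. sqrt u * exp (- pi * sqrt u))"
  proof -
    have "(\<lambda>u. u * (exp (pi * sqrt (u - 1/36)) - exp (- (pi * sqrt (u - 1/36)))) /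
        (sqrt (u - 1/36) * ((exp (pi * sqrt (u - 1/36)) - exp (- (pi * sqrt (u - 1/36))))^2 + 1)))
      \<sim>[at_top] (\<lambda>u. sqrt u * exp (- pi * sqrt u))"
      by (rule asymp_equivI') real_asymp
    \<comment> \<open>Here \<open>E\<close> stands for \<open>2 * sinh\<close>, so that only
      exponentials without halves are left to expand.\<close>
    moreover have "u * E / (a * (E^2 + 1)) = u / 2 * (E / 2) / (a * ((E / 2)^2 + 1/4))" for u a E :: real
    proof -
      have "a * ((E / 2)^2 + 1/4) = a * (E^2 + 1) / 4" by (simp add: power_divide)
      thus ?thesis by (simp only:) simp
    qed
    ultimately show ?thesis unfolding sinh_field_def by simp
  qed
  from asymp_equiv_mult[OF asymp_equiv_refl this]
  have *: "(\<lambda>u. pi * sqrt 3 * (u / 2 * sinh (pi * sqrt (u - 1/36)) /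
        (sqrt (u - 1/36) * ((sinh (pi * sqrt (u - 1/36)))^2 + 1/4))))
      \<sim>[at_top] (\<lambda>u. pi * sqrt 3 * (sqrt u * exp (- pi * sqrt u)))" .
  have "filterlim (\<lambda>s::real. 2 * s / 3) at_top at_top" by real_asymp
  from asymp_equiv_compose'[OF * this]
  show ?thesis
  proof (rule asymp_equiv_transfer; intro always_eventually allI)
    fix s :: real
    have sqrt3: "pi / sqrt 3 = pi * sqrt 3 / 3" by (simp add: field_simps)
    have "pi * sqrt 3 * ((2 * s / 3) / 2 * S / T) = s * (pi / sqrt 3 * S / T)" for S T
      unfolding sqrt3 by simp
    thus "pi * sqrt 3 * ((2 * s / 3) / 2 * sinh (pi * sqrt (2 * s / 3 - 1/36)) /
        (sqrt (2 * s / 3 - 1/36) * ((sinh (pi * sqrt (2 * s / 3 - 1/36)))^2 + 1/4))) = s * pentagonal_laplace s"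
      by (simp add: pentagonal_laplace_def Let_def)
    have "sqrt 3 * sqrt (2 * s / 3) = sqrt (2 * s)" "sqrt (2 * s / 3) = sqrt (2/3) * sqrt s"
      by (simp_all flip: real_sqrt_mult)
    thus "pi * sqrt 3 * (sqrt (2 * s / 3) * exp (- pi * sqrt (2 * s / 3))) =
        pi * sqrt (2 * s) * exp (- pi * sqrt (2/3) * sqrt s)"
      by (metis mult.assoc)
  qed
qed

text \<open>Lowering the rate by the factor 9/10 pays for the denominator \<open>s^2\<close>, which
  makes sums over multiples of \<open>m\<close> converge. The rate stays large enough to make the
  arguments \<open>s\<close> from \<open>2 * m\<close> on negligible.\<close>

lemma pentagonal_laplace_upper_bound:
  "eventually (\<lambda>s. pentagonal_laplace s \<le> exp (- (9/10) * pi * sqrt (2/3) * sqrt s) / s^2) at_top"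
proof -
  have *: "eventually (\<lambda>u. 3 * (sinh (pi * sqrt (u - 1/36)) /
       (sqrt (u - 1/36) * ((sinh (pi * sqrt (u - 1/36)))^2 + 1/4))) \<le>
      exp (- (9/10) * pi * sqrt u) / (9/4 * u^2)) at_top"
    unfolding sinh_field_def by real_asymp
  have "filterlim (\<lambda>s::real. 2 * s / 3) at_top at_top" by real_asymp
  from eventually_compose_filterlim[OF * this] eventually_ge_at_top[of 1]
  show ?thesis
  proof eventually_elim
    case (elim s)
    let ?S = "sinh (pi * sqrt (2 * s / 3 - 1/36)) /
        (sqrt (2 * s / 3 - 1/36) * ((sinh (pi * sqrt (2 * s / 3 - 1/36)))^2 + 1/4))"
    have S: "?S \<ge> 0" using elim by (intro divide_nonneg_nonneg mult_nonneg_nonneg) auto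
    have "pentagonal_laplace s = pi / sqrt 3 * ?S"
      by (simp add: pentagonal_laplace_def Let_def)
    also have "\<dots> \<le> 3 * ?S"
    proof (rule mult_right_mono[OF _ S])
      \<comment> \<open>Both sides are separated by 9/2, since 3/2 is at most
        \<open>sqrt 3\<close>.\<close>
      have "pi \<le> 3 * sqrt 3"
        using pi_less_4 real_le_rsqrt[of "3/2" 3] by (simp add: power2_eq_square)
      thus "pi / sqrt 3 \<le> 3" by (simp add: field_simps)
    qed
    also have "\<dots> \<le> exp (- (9/10) * pi * sqrt (2 * s / 3)) / (9/4 * (2 * s / 3)^2)"
      by (rule elim)
    also have "sqrt (2 * s / 3) = sqrt (2/3) * sqrt s" by (simp flip: real_sqrt_mult)
    also have "9/4 * (2 * s / 3)^2 = s^2" by (simp add: power2_eq_square)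
    finally show ?case by (simp add: mult.assoc)
  qed
qed

subsection \<open>The maximum of independent exponential variables\<close>

text \<open>Since \<open>m\<close> is not in \<open>J\<close>, the variable \<open>X m\<close> is
  independent of the family over \<open>J\<close>. Fubini for the product law turns the probability
  into the expectation of \<open>h (X m)\<close>, where \<open>h\<close> is the distribution
  function of the maximum over \<open>J\<close>.\<close>

lemma (in prob_space) prob_all_le_finite:
  fixes X :: "nat \<Rightarrow> 'a \<Rightarrow> real"
  assumes ind: "indep_vars (\<lambda>_. borel) X {1..}"
    and dist: "\<And>i. i \<ge> 1 \<Longrightarrow> distributed M lborel (X i) (exponential_density (real i))"
    and J: "finite J" "J \<subseteq> {1..}" "m \<notin> J" and m: "m \<ge> 1"
  shows "prob {\<omega> \<in> space M. \<forall>i\<in>J. X i \<omega> \<le> X m \<omega>} =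
    (\<integral>x. indicator {0<..} x * (real m * exp (- real m * x) * (\<Prod>i\<in>J. 1 - exp (- x) ^ i)) \<partial>lborel)"
proof -
  have X [measurable]: "X i \<in> borel_measurable M" if "i \<ge> 1" for i
    using distributed_measurable[OF dist[OF that]] by simp
  define Y where "Y \<omega> = (\<lambda>i\<in>J. X i \<omega>)" for \<omega>
  define N where "N = PiM J (\<lambda>_. borel :: real measure)"
  have [measurable]: "(\<lambda>f. f i) \<in> borel_measurable N" if "i \<in> J" for i
    unfolding N_def using that by measurable
  \<comment> \<open>The single variable is treated as a family over \<open>{m}\<close>, so that
    independence of restrictions to disjoint index sets applies.\<close>
  define Z where "Z \<omega> = (\<lambda>i\<in>{m}. X i \<omega>)" for \<omega>
  define L where "L = PiM {m} (\<lambda>_. borel :: real measure)"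
  have [measurable]: "(\<lambda>f. f m) \<in> borel_measurable L"
    unfolding L_def by measurable
  have ZY: "indep_var L Z N Y"
    unfolding L_def N_def Z_def[abs_def] Y_def[abs_def]
    using J m by (intro indep_var_restrict[OF ind]) auto
  have Z [measurable]: "Z \<in> M \<rightarrow>\<^sub>M L" and Y [measurable]: "Y \<in> M \<rightarrow>\<^sub>M N"
    and prod: "distr M L Z \<Otimes>\<^sub>M distr M N Y = distr M (L \<Otimes>\<^sub>M N) (\<lambda>\<omega>. (Z \<omega>, Y \<omega>))"
    using ZY unfolding indep_var_distribution_eq by auto
  define E where "E = {p \<in> space (L \<Otimes>\<^sub>M N). \<forall>i\<in>J. snd p i \<le> fst p m}"
  have E [measurable]: "E \<in> sets (L \<Otimes>\<^sub>M N)"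
    unfolding E_def using J(1) by measurable
  have "sets (distr M L Z \<Otimes>\<^sub>M distr M N Y) = sets (L \<Otimes>\<^sub>M N)"
    by (intro sets_pair_measure_cong sets_distr)
  hence E': "E \<in> sets (distr M L Z \<Otimes>\<^sub>M distr M N Y)" using E by blast
  interpret Y: prob_space "distr M N Y" by (rule prob_space_distr[OF Y])
  define h where "h x = prob {\<omega> \<in> space M. \<forall>i\<in>J. X i \<omega> \<le> x}" for x
  \<comment> \<open>Measurability comes from monotonicity, because the product formula for
    \<open>h\<close> is established only for nonnegative arguments.\<close>
  have [measurable]: "h \<in> borel_measurable borel"
  proof (rule borel_measurable_mono, rule monoI)
    fix x y :: real assume "x \<le> y"
    moreover have "{\<omega> \<in> space M. \<forall>i\<in>J. X i \<omega> \<le> y} \<in> events"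
    proof (intro sets.sets_Collect_finite_All J(1))
      fix i assume "i \<in> J"
      hence "X i \<in> borel_measurable M" using J(2) by (intro X) auto
      thus "{\<omega> \<in> space M. X i \<omega> \<le> y} \<in> events" by (rule borel_measurable_le) simp
    qed
    ultimately show "h x \<le> h y"
      unfolding h_def by (intro finite_measure_mono) force+
  qed
  have cdf: "h x = (\<Prod>i\<in>J. 1 - exp (- x) ^ i)" if "x \<ge> 0" for x
  proof (cases "J = {}")
    case True
    thus ?thesis by (simp add: h_def prob_space)
  next
    case False
    have "{\<omega> \<in> space M. \<forall>i\<in>J. X i \<omega> \<le> x} = (\<Inter>i\<in>J. X i -` {..x} \<inter> space M)"
      using False by auto
    also have "prob \<dots> = (\<Prod>i\<in>J. prob (X i -` {..x} \<inter> space M))"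
      using J False by (intro indep_varsD[OF ind]) auto
    also have "\<dots> = (\<Prod>i\<in>J. 1 - exp (- x) ^ i)"
    proof (intro prod.cong refl)
      fix i assume "i \<in> J"
      hence i: "i \<ge> 1" using J by auto
      have "X i -` {..x} \<inter> space M = {\<omega> \<in> space M. X i \<omega> \<le> x}" by auto
      thus "prob (X i -` {..x} \<inter> space M) = 1 - exp (- x) ^ i"
        using exponential_distributedD_le[OF dist[OF i] that] i
        by (simp add: exp_of_nat_mult[symmetric] mult.commute)
    qed
    finally show ?thesis unfolding h_def .
  qed
  have "emeasure M {\<omega> \<in> space M. \<forall>i\<in>J. X i \<omega> \<le> X m \<omega>}
      = emeasure (distr M (L \<Otimes>\<^sub>M N) (\<lambda>\<omega>. (Z \<omega>, Y \<omega>))) E"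
  proof -
    have "{\<omega> \<in> space M. \<forall>i\<in>J. X i \<omega> \<le> X m \<omega>} = (\<lambda>\<omega>. (Z \<omega>, Y \<omega>)) -` E \<inter> space M"
      using measurable_space[OF Y] measurable_space[OF Z]
      by (auto simp: E_def Y_def Z_def space_pair_measure)
    thus ?thesis
      by (simp only: emeasure_distr[OF measurable_Pair[OF Z Y] E])
  qed
  also have "\<dots> = (\<integral>\<^sup>+z. emeasure (distr M N Y) (Pair z -` E) \<partial>distr M L Z)"
    unfolding prod[symmetric] by (rule Y.emeasure_pair_measure_alt[OF E'])
  also have "\<dots> = (\<integral>\<^sup>+\<omega>. emeasure (distr M N Y) (Pair (Z \<omega>) -` E) \<partial>M)"
    by (intro nn_integral_distr Z Y.measurable_emeasure_Pair E')
  also have "\<dots> = (\<integral>\<^sup>+\<omega>. ennreal (h (X m \<omega>)) \<partial>M)"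
  proof (intro nn_integral_cong)
    fix \<omega> assume \<omega>: "\<omega> \<in> space M"
    have "Pair (Z \<omega>) -` E \<in> sets N" using sets_Pair1[OF E] .
    hence "emeasure (distr M N Y) (Pair (Z \<omega>) -` E) = emeasure M (Y -` (Pair (Z \<omega>) -` E) \<inter> space M)"
      by (rule emeasure_distr[OF Y])
    also have "Y -` (Pair (Z \<omega>) -` E) \<inter> space M = {\<omega>' \<in> space M. \<forall>i\<in>J. X i \<omega>' \<le> X m \<omega>}"
      using measurable_space[OF Y] measurable_space[OF Z \<omega>]
      by (auto simp: E_def space_pair_measure Y_def Z_def)
    finally show "emeasure (distr M N Y) (Pair (Z \<omega>) -` E) = ennreal (h (X m \<omega>))"
      by (simp add: emeasure_eq_measure h_def)
  qed
  also have "\<dots> = (\<integral>\<^sup>+x. ennreal (exponential_density (real m) x) * ennreal (h x) \<partial>lborel)"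
    by (rule distributed_nn_integral[OF dist[OF m], symmetric]) simp
  also have "\<dots> = (\<integral>\<^sup>+x. ennreal (indicator {0<..} x * (real m * exp (- real m * x) * (\<Prod>i\<in>J. 1 - exp (- x) ^ i))) \<partial>lborel)"
  proof (intro nn_integral_cong_AE)
    show "AE x in lborel. ennreal (exponential_density (real m) x) * ennreal (h x) =
        ennreal (indicator {0<..} x * (real m * exp (- real m * x) * (\<Prod>i\<in>J. 1 - exp (- x) ^ i)))"
      using AE_lborel_singleton[of 0]
    proof eventually_elim
      case (elim x)
      show ?case
      proof (cases "x > 0")
        case True
        thus ?thesis
          by (simp add: cdf exponential_density_def ennreal_mult' mult.commute)
      qed (use elim in \<open>simp add: exponential_density_def\<close>)
    qed
  qed
  finally have "prob {\<omega> \<in> space M. \<forall>i\<in>J. X i \<omega> \<le> X m \<omega>} = enn2real \<dots>"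
    by (simp add: measure_def)
  also have "\<dots> = (\<integral>x. indicator {0<..} x * (real m * exp (- real m * x) * (\<Prod>i\<in>J. 1 - exp (- x) ^ i)) \<partial>lborel)"
    by (intro integral_eq_nn_integral[symmetric] always_eventually allI)
       (auto simp: indicator_def power_le_one intro!: mult_nonneg_nonneg prod_nonneg)
  finally show ?thesis .
qed

text \<open>Invisible from the alternating series, but immediate for the limit of products with
  nonnegative factors.\<close>

lemma suminf_pentagonal_nonneg:
  assumes "0 \<le> q" "q < 1"
  shows "(\<Sum>j. pentagonal_term q j) \<ge> 0"
  using assms by (intro LIMSEQ_le_const[OF pentagonal_number_theorem] exI[of _ 0])
                 (auto intro!: prod_nonneg simp: power_le_one)

text \<open>The event is the decreasing intersection of the finite comparisons \<open>A n\<close>.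
  Dominated convergence with majorant \<open>m * exp (- m * x)\<close> passes to the limit in their
  integrals. Dividing by \<open>1 - exp (- m * x)\<close> removes the factor \<open>i = m\<close>
  from the full Euler product.\<close>

lemma (in prob_space) prob_is_supremum:
  fixes X :: "nat \<Rightarrow> 'a \<Rightarrow> real"
  assumes ind: "indep_vars (\<lambda>_. borel) X {1..}"
    and dist: "\<And>i. i \<ge> 1 \<Longrightarrow> distributed M lborel (X i) (exponential_density (real i))"
    and m: "m \<ge> 1"
  shows "prob {\<omega> \<in> space M. ereal (X m \<omega>) = (SUP i\<in>{1..}. ereal (X i \<omega>))} =
    (\<integral>x. indicator {0<..} x * (real m * exp (- real m * x) / (1 - exp (- real m * x)) *
        (\<Sum>j. pentagonal_term (exp (- x)) j)) \<partial>lborel)"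
proof -
  have X [measurable]: "X i \<in> borel_measurable M" if "i \<ge> 1" for i
    using distributed_measurable[OF dist[OF that]] by simp
  define J where "J n = {1..n} - {m}" for n
  define A where "A n = {\<omega> \<in> space M. \<forall>i\<in>J n. X i \<omega> \<le> X m \<omega>}" for n
  define f where "f n x = indicator {0<..} x * (real m * exp (- real m * x) * (\<Prod>i\<in>J n. 1 - exp (- x) ^ i))"
    for n and x :: real
  have [measurable]: "A n \<in> sets M" for n
    unfolding A_def using m by measurable (auto simp: J_def)
  have "{\<omega> \<in> space M. ereal (X m \<omega>) = (SUP i\<in>{1..}. ereal (X i \<omega>))} = (\<Inter>n. A n)"
  proof (intro equalityI subsetI)
    fix \<omega> assume "\<omega> \<in> {\<omega> \<in> space M. ereal (X m \<omega>) = (SUP i\<in>{1..}. ereal (X i \<omega>))}"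
    hence "\<omega> \<in> space M" and eq: "ereal (X m \<omega>) = (SUP i\<in>{1..}. ereal (X i \<omega>))" by auto
    moreover have "X i \<omega> \<le> X m \<omega>" if "i \<ge> 1" for i
      using SUP_upper[of i "{1..}" "\<lambda>i. ereal (X i \<omega>)"] that unfolding eq[symmetric] by auto
    ultimately show "\<omega> \<in> (\<Inter>n. A n)" by (auto simp: A_def J_def)
  next
    fix \<omega> assume \<omega>: "\<omega> \<in> (\<Inter>n. A n)"
    have "X i \<omega> \<le> X m \<omega>" if "i \<ge> 1" for i
      using \<omega> that by (cases "i = m") (auto simp: A_def J_def dest!: spec[of _ i])
    hence "(SUP i\<in>{1..}. ereal (X i \<omega>)) = ereal (X m \<omega>)"
      using m by (intro antisym SUP_least SUP_upper) auto
    thus "\<omega> \<in> {\<omega> \<in> space M. ereal (X m \<omega>) = (SUP i\<in>{1..}. ereal (X i \<omega>))}"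
      using \<omega> by (auto simp: A_def)
  qed
  moreover have "(\<lambda>n. prob (A n)) \<longlonglongrightarrow> prob (\<Inter>n. A n)"
  proof (rule finite_Lim_measure_decseq)
    show "decseq A" by (auto simp: decseq_def A_def J_def)
  qed auto
  moreover have "prob (A n) = (\<integral>x. f n x \<partial>lborel)" for n
    unfolding A_def f_def by (rule prob_all_le_finite[OF ind dist]) (use m in \<open>auto simp: J_def\<close>)
  moreover have "(\<lambda>n. \<integral>x. f n x \<partial>lborel) \<longlonglongrightarrow>
     (\<integral>x. indicator {0<..} x * (real m * exp (- real m * x) / (1 - exp (- real m * x)) *
        (\<Sum>j. pentagonal_term (exp (- x)) j)) \<partial>lborel)"
  proof (rule integral_dominated_convergence)
    show "integrable lborel (\<lambda>x. real m * (indicator {0<..} x * exp (- real m * x)))"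
      using has_bochner_integral_exp_halfline[of "real m"] m
      by (intro integrable_mult_right) (auto simp: has_bochner_integral_iff)
    show "AE x in lborel. norm (f n x) \<le> real m * (indicator {0<..} x * exp (- real m * x))" for n
    proof (intro always_eventually allI)
      fix x :: real
      show "norm (f n x) \<le> real m * (indicator {0<..} x * exp (- real m * x))"
      proof (cases "x > 0")
        case True
        have "0 \<le> (\<Prod>i\<in>J n. 1 - exp (- x) ^ i)" "(\<Prod>i\<in>J n. 1 - exp (- x) ^ i) \<le> 1"
          using True by (auto intro!: prod_nonneg prod_le_1 simp: power_le_one)
        thus ?thesis using True by (simp add: f_def abs_mult mult_left_le)
      qed (simp add: f_def)
    qed
    show "AE x in lborel. (\<lambda>n. f n x) \<longlonglongrightarrow> indicator {0<..} x * (real m * exp (- real m * x) / (1 - exp (- real m * x)) *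
        (\<Sum>j. pentagonal_term (exp (- x)) j))"
    proof (intro always_eventually allI)
      fix x :: real
      show "(\<lambda>n. f n x) \<longlonglongrightarrow> indicator {0<..} x * (real m * exp (- real m * x) / (1 - exp (- real m * x)) *
        (\<Sum>j. pentagonal_term (exp (- x)) j))"
      proof (cases "x > 0")
        case True
        have em: "exp (- x) ^ m = exp (- real m * x)"
          by (simp add: exp_of_nat_mult[symmetric])
        have ne: "1 - exp (- real m * x) \<noteq> 0" using True m by simp
        have "(\<lambda>n. indicator {0<..} x * (real m * exp (- real m * x) / (1 - exp (- real m * x)) *
           (\<Prod>i=1..n. 1 - exp (- x) ^ i))) \<longlonglongrightarrow> indicator {0<..} x *
           (real m * exp (- real m * x) / (1 - exp (- real m * x)) * (\<Sum>j. pentagonal_term (exp (- x)) j))"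
          using True by (intro tendsto_mult tendsto_const pentagonal_number_theorem) auto
        moreover have "eventually (\<lambda>n. indicator {0<..} x * (real m * exp (- real m * x) / (1 - exp (- real m * x)) *
           (\<Prod>i=1..n. 1 - exp (- x) ^ i)) = f n x) sequentially"
          using eventually_ge_at_top[of m]
        proof eventually_elim
          case (elim n)
          have "(\<Prod>i=1..n. 1 - exp (- x) ^ i) = (1 - exp (- x) ^ m) * (\<Prod>i\<in>J n. 1 - exp (- x) ^ i)"
            unfolding J_def using elim m by (intro prod.remove) auto
          thus ?case using ne unfolding f_def em by simp
        qed
        ultimately show ?thesis by (rule Lim_transform_eventually)
      qed (simp add: f_def)
    qed
  qed (auto simp: f_def)
  ultimately show ?thesis using LIMSEQ_unique by simp
qed

section \<open>Summation over the geometric series and negligibility of its tail\<close>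

lemma pentagonal_laplace_nonneg: "s \<ge> 1 \<Longrightarrow> pentagonal_laplace s \<ge> 0"
  unfolding pentagonal_laplace_def Let_def
  by (intro divide_nonneg_nonneg mult_nonneg_nonneg) auto

lemma summable_pentagonal_laplace:
  assumes "m \<ge> (1::nat)"
  shows "summable (\<lambda>r. pentagonal_laplace (real (Suc r * m)))"
proof (rule summable_comparison_test_ev)
  show "summable (\<lambda>r. inverse (real (Suc r) ^ 2))"
    by (subst summable_Suc_iff) (rule inverse_power_summable, simp)
  have "filterlim (\<lambda>r. real (Suc r * m)) at_top sequentially"
  proof (rule filterlim_at_top_mono[OF filterlim_real_sequentially])
    show "\<forall>\<^sub>F r in sequentially. real r \<le> real (Suc r * m)"
      using assms by (intro always_eventually allI of_nat_mono) (cases m, auto)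
  qed
  from eventually_compose_filterlim[OF pentagonal_laplace_upper_bound this]
  show "\<forall>\<^sub>F r in sequentially. norm (pentagonal_laplace (real (Suc r * m))) \<le> inverse (real (Suc r) ^ 2)"
  proof eventually_elim
    case (elim r)
    have "real (Suc r * m) \<ge> real (Suc r)" using assms by (intro of_nat_mono) (cases m, auto)
    hence le: "real (Suc r) ^ 2 \<le> real (Suc r * m) ^ 2" by (intro power_mono) auto
    note elim
    also have "exp (- (9/10) * pi * sqrt (2/3) * sqrt (real (Suc r * m))) / real (Suc r * m) ^ 2
       \<le> 1 / real (Suc r) ^ 2"
      using le by (intro frac_le) auto
    finally show ?case
      using pentagonal_laplace_nonneg[of "real (Suc r * m)"] assms
      by (simp add: inverse_eq_divide del: of_nat_mult)
  qed
qed

text \<open>Expand \<open>1 / (1 - exp (- m * x))\<close> geometrically; the summand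
  \<open>r\<close> then integrates to the Laplace transform at \<open>Suc r * m\<close>. All
  summands are nonnegative, so summability of these values justifies the interchange.\<close>

lemma (in prob_space) prob_is_supremum_sums:
  fixes X :: "nat \<Rightarrow> 'a \<Rightarrow> real"
  assumes ind: "indep_vars (\<lambda>_. borel) X {1..}"
    and dist: "\<And>i. i \<ge> 1 \<Longrightarrow> distributed M lborel (X i) (exponential_density (real i))"
    and m: "m \<ge> 1"
  shows "(\<lambda>r. real m * pentagonal_laplace (real (Suc r * m))) sums
           prob {\<omega> \<in> space M. ereal (X m \<omega>) = (SUP i\<in>{1..}. ereal (X i \<omega>))}"
proof -
  define G where "G x = (\<Sum>j. pentagonal_term (exp (- x)) j)" for x
  define f where "f r x = real m * (indicator {0<..} x * (exp (- real (Suc r * m) * x) * G x))" for r x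
  have hb: "has_bochner_integral lborel (f r) (real m * pentagonal_laplace (real (Suc r * m)))" for r
    unfolding f_def G_def using m
    by (intro has_bochner_integral_mult_right has_bochner_integral_pentagonal) (simp del: of_nat_mult)
  have norm_f: "norm (f r x) = f r x" for r x
  proof (cases "x > 0")
    case True
    thus ?thesis using suminf_pentagonal_nonneg[of "exp (- x)"]
      by (simp add: f_def G_def abs_mult)
  qed (simp add: f_def)
  have f_sums: "(\<lambda>r. f r x) sums (indicator {0<..} x * (real m * exp (- real m * x) / (1 - exp (- real m * x)) * G x))" for x
  proof (cases "x > 0")
    case True
    have "(\<lambda>r. exp (- real m * x) ^ r) sums (1 / (1 - exp (- real m * x)))"
      using True m by (intro geometric_sums) auto
    from sums_mult[OF this, of "real m * exp (- real m * x) * G x"]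
    show ?thesis using True
      by (simp add: f_def exp_of_nat_mult[symmetric] exp_add[symmetric] algebra_simps flip: exp_minus)
  qed (simp add: f_def)
  have summ: "summable (\<lambda>r. \<integral>x. norm (f r x) \<partial>lborel)"
    unfolding norm_f has_bochner_integral_integral_eq[OF hb]
    by (intro summable_mult summable_pentagonal_laplace m)
  have "(\<lambda>r. integral\<^sup>L lborel (f r)) sums (\<integral>x. (\<Sum>r. f r x) \<partial>lborel)"
  proof (intro sums_integral always_eventually allI summ)
    show "integrable lborel (f r)" for r using hb[of r] by (auto simp: has_bochner_integral_iff)
    show "summable (\<lambda>r. norm (f r x))" for x unfolding norm_f using f_sums by (rule sums_summable)
  qed
  hence "(\<lambda>r. real m * pentagonal_laplace (real (Suc r * m))) sums
      (\<integral>x. indicator {0<..} x * (real m * exp (- real m * x) / (1 - exp (- real m * x)) * G x) \<partial>lborel)"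
    unfolding has_bochner_integral_integral_eq[OF hb] sums_unique[OF f_sums, symmetric] .
  also have "(\<integral>x. indicator {0<..} x * (real m * exp (- real m * x) / (1 - exp (- real m * x)) * G x) \<partial>lborel)
      = prob {\<omega> \<in> space M. ereal (X m \<omega>) = (SUP i\<in>{1..}. ereal (X i \<omega>))}"
    unfolding G_def by (rule prob_is_supremum[OF ind dist m, symmetric])
  finally show ?thesis .
qed

text \<open>All arguments are at least \<open>2 * m\<close>, so the upper bound yields the
  exponential rate \<open>6/5 * c\<close> in \<open>sqrt m\<close>, which beats the rate
  \<open>c\<close> of the main term. The inverse squares sum to the constant
  \<open>K\<close>.\<close>

lemma pentagonal_laplace_tail:
  "(\<lambda>m. \<Sum>r. real m * pentagonal_laplace (real (Suc (Suc r) * m))) \<in>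
     o(\<lambda>m. pi * sqrt (2 * real m) * exp (- pi * sqrt (2/3) * sqrt (real m)))"
proof -
  define c where "c = pi * sqrt (2/3)"
  have c: "c > 0" by (simp add: c_def)
  define K where "K = (\<Sum>r. inverse (real (Suc (Suc r)) ^ 2))"
  have K: "summable (\<lambda>r. inverse (real (Suc (Suc r)) ^ 2))"
    by (subst summable_Suc_iff, subst summable_Suc_iff) (rule inverse_power_summable, simp)
  obtain s0 where s0: "\<And>s. s \<ge> s0 \<Longrightarrow> pentagonal_laplace s \<le> exp (- (9/10) * pi * sqrt (2/3) * sqrt s) / s^2"
    using pentagonal_laplace_upper_bound unfolding eventually_at_top_linorder by blast
  have "eventually (\<lambda>m. norm (\<Sum>r. real m * pentagonal_laplace (real (Suc (Suc r) * m))) \<le>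
          K * norm (exp (- (6/5) * c * sqrt (real m)))) at_top"
    using eventually_ge_at_top[of 1] eventually_ge_at_top[of "nat \<lceil>s0\<rceil>"]
  proof eventually_elim
    case (elim m)
    let ?s = "\<lambda>r. real (Suc (Suc r) * m)"
    have summ: "summable (\<lambda>r. real m * pentagonal_laplace (?s r))"
      using summable_pentagonal_laplace[OF elim(1)] by (subst summable_Suc_iff) (rule summable_mult)
    have bound: "real m * pentagonal_laplace (?s r) \<le> exp (- (6/5) * c * sqrt (real m)) * inverse (real (Suc (Suc r)) ^ 2)" for r
    proof -
      have s_ge: "?s r \<ge> 2 * real m" by simp
      have "?s r \<ge> s0" using elim(2) s_ge by linarith
      \<comment> \<open>The rational 4/3 lies below \<open>sqrt 2\<close>, and 9/10 times 4/3 is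
        6/5.\<close>
      have "4/3 * sqrt (real m) = sqrt (16/9 * real m)"
        by (simp add: real_sqrt_mult real_sqrt_divide)
      also have "\<dots> \<le> sqrt (?s r)" using s_ge by (intro real_sqrt_le_mono) linarith
      finally have "c * (4/3 * sqrt (real m)) \<le> c * sqrt (?s r)" using c by (intro mult_left_mono) auto
      hence ex: "exp (- (9/10) * pi * sqrt (2/3) * sqrt (?s r)) \<le> exp (- (6/5) * c * sqrt (real m))"
        by (simp add: c_def mult.assoc)
      have "real m * pentagonal_laplace (?s r) \<le> real m * (exp (- (9/10) * pi * sqrt (2/3) * sqrt (?s r)) / (?s r)^2)"
        by (intro mult_left_mono s0 \<open>?s r \<ge> s0\<close>) auto
      also have "\<dots> \<le> real m * (exp (- (6/5) * c * sqrt (real m)) / (?s r)^2)"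
        by (intro mult_left_mono divide_right_mono ex) auto
      also have "\<dots> = exp (- (6/5) * c * sqrt (real m)) * inverse (real (Suc (Suc r)) ^ 2) * (1 / real m)"
      proof -
        have "a * (e / (b * a)^2) = e * inverse (b^2) * (1 / a)" if "a \<noteq> 0" for a b e :: real
          using that by (simp add: power2_eq_square divide_inverse)
        thus ?thesis using elim(1) unfolding of_nat_mult by simp
      qed
      also have "\<dots> \<le> exp (- (6/5) * c * sqrt (real m)) * inverse (real (Suc (Suc r)) ^ 2) * 1"
        using elim(1) by (intro mult_left_mono) auto
      finally show ?thesis by simp
    qed
    have nonneg: "0 \<le> real m * pentagonal_laplace (?s r)" for r
      using elim(1) by (intro mult_nonneg_nonneg pentagonal_laplace_nonneg) (auto simp del: of_nat_mult)
    have "(\<Sum>r. real m * pentagonal_laplace (?s r)) \<le> (\<Sum>r. exp (- (6/5) * c * sqrt (real m)) * inverse (real (Suc (Suc r)) ^ 2))"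
      by (intro suminf_le bound summ summable_mult K)
    also have "\<dots> = exp (- (6/5) * c * sqrt (real m)) * K"
      unfolding K_def by (intro suminf_mult K)
    finally show ?case
      using suminf_nonneg[OF summ nonneg] by (simp add: mult.commute)
  qed
  hence "(\<lambda>m. \<Sum>r. real m * pentagonal_laplace (real (Suc (Suc r) * m))) \<in> O(\<lambda>m. exp (- (6/5) * c * sqrt (real m)))"
    by (rule bigoI)
  also have "(\<lambda>m::nat. exp (- (6/5) * c * sqrt (real m))) \<in> o(\<lambda>m. pi * sqrt (2 * real m) * exp (- c * sqrt (real m)))"
    using c by real_asymp
  finally show ?thesis by (simp add: c_def)
qed

theorem theorem6:
  fixes M :: "'a measure" and X :: "nat \<Rightarrow> 'a \<Rightarrow> real"
  assumes "prob_space M"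
    and "prob_space.indep_vars M (\<lambda>_. borel) X {1..}"
    and "\<And>i. i \<ge> 1 \<Longrightarrow> distributed M lborel (X i) (exponential_density (real i))"
  shows "(\<lambda>m::nat. measure M {\<omega> \<in> space M. ereal (X m \<omega>) = (SUP i\<in>{1..}. ereal (X i \<omega>))})
           \<sim>[at_top] (\<lambda>m. pi * sqrt (2 * real m) * exp (- pi * sqrt (2/3) * sqrt (real m)))"
proof -
  interpret prob_space M by fact
  have "(\<lambda>m. real m * pentagonal_laplace (real m) + (\<Sum>r. real m * pentagonal_laplace (real (Suc (Suc r) * m))))
     \<sim>[at_top] (\<lambda>m. pi * sqrt (2 * real m) * exp (- pi * sqrt (2/3) * sqrt (real m)))"
    using asymp_equiv_compose'[OF pentagonal_laplace_asymp filterlim_real_sequentially]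
          pentagonal_laplace_tail
    by (simp add: asymp_equiv_add_right)
  \<comment> \<open>Splitting off the first summand of the series isolates the main term. The index
    0 is excluded, as nothing is assumed about \<open>X 0\<close>.\<close>
  moreover have "eventually (\<lambda>m. real m * pentagonal_laplace (real m) + (\<Sum>r. real m * pentagonal_laplace (real (Suc (Suc r) * m)))
     = prob {\<omega> \<in> space M. ereal (X m \<omega>) = (SUP i\<in>{1..}. ereal (X i \<omega>))}) at_top"
    using eventually_ge_at_top[of 1]
  proof eventually_elim
    case (elim m)
    have s: "(\<lambda>r. real m * pentagonal_laplace (real (Suc r * m))) sums
        prob {\<omega> \<in> space M. ereal (X m \<omega>) = (SUP i\<in>{1..}. ereal (X i \<omega>))}"
      by (rule prob_is_supremum_sums[OF assms(2,3) elim])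
    show ?case
      using suminf_split_head[OF sums_summable[OF s]] sums_unique[OF s] by simp
  qed
  ultimately show ?thesis by (rule asymp_equiv_transfer) simp
qed

end
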